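(* Assume the axiom of choice. For every set $S$ there is a $T_2$-anonymous predictor $P:{}^{\mathbb{R}}S\to{}^{\mathbb{R}}S$ such that for every scenario $f\in{}^{\mathbb{R}}S$, the set $\{x\in\mathbb{R}: P(f)(x)\neq f(x)\}$ is countable.
   Context: For a set $S$, ${}^{\mathbb{R}}S$ is the set of all functions (scenarios) $f:\mathbb{R}\to S$. A predictor is a function $P:{}^{\mathbb{R}}S\to{}^{\mathbb{R}}S$ such that for all $f,g\in{}^{\mathbb{R}}S$ and all $x\in\mathbb{R}$, if $f\upharpoonright(-\infty,x)=g\upharpoonright(-\infty,x)$ then $P(f)(x)=P(g)(x)$. For a family $T$ of functions $\mathbb{R}\to\mathbb{R}$, a predictor $P$ is $T$-anonymous if $P(f\circ t)=P(f)\circ t$ for every scenario $f$ and every $t\in T$. $T_2$ is the set of all functions $t:\mathbb{R}\to\mathbb{R}$ of the form $t(y)=ay+c$ with $a>0$, $c\in\mathbb{R}$. *)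

theory Defs
  imports Complex_Main "HOL-Library.Countable_Set"
begin

definition predictor :: "((real \<Rightarrow> 's) \<Rightarrow> (real \<Rightarrow> 's)) \<Rightarrow> bool" where
  "predictor P \<longleftrightarrow> (\<forall>f g x. (\<forall>y. y < x \<longrightarrow> f y = g y) \<longrightarrow> P f x = P g x)"

definition anonymous :: "(real \<Rightarrow> real) set \<Rightarrow> ((real \<Rightarrow> 's) \<Rightarrow> (real \<Rightarrow> 's)) \<Rightarrow> bool" where
  "anonymous T P \<longleftrightarrow> (\<forall>f. \<forall>t\<in>T. P (f \<circ> t) = P f \<circ> t)"

definition T2 :: "(real \<Rightarrow> real) set" where
  "T2 = {t. \<exists>a c. a > 0 \<and> t = (\<lambda>y. a * y + c)}"

end

theory Submission
  imports Defs
begin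

text \<open>
  Call \<open>s \<in> T2\<close> a symmetry of the past of \<open>f\<close> at \<open>x\<close> if \<open>f \<circ> s = f\<close> below \<open>x\<close>.  If some such
  symmetry moves \<open>x\<close> to the left, guess \<open>f (s x)\<close>, preferring translations to other maps.
  Otherwise take the least scenario \<open>g\<close>, in a fixed well-order, some affine reparametrisation
  \<open>g \<circ> t\<close> of which agrees with \<open>f\<close> below \<open>x\<close>, and guess \<open>g (t x)\<close>; two reparametrisations
  \<open>t, t'\<close> with \<open>t' x < t x\<close> would give the left-moving symmetry \<open>t\<^sup>-\<^sup>1 \<circ> t'\<close>, so \<open>t x\<close>
  is determined.

  The least scenario only increases with \<open>x\<close>, so guesses of the last kind fail on a well-ordered,
  hence countable, set.  Guesses by symmetry are right whenever the symmetry commutes with one that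
  persists beyond \<open>x\<close>.  Two symmetries that do not commute have a translation as commutator, so
  \<open>f\<close> is periodic on a ray; the end point \<open>Z\<close> of the maximal such ray is fixed by every symmetry
  of the past at any point beyond \<open>Z\<close>, so non-commuting symmetries without a translation among them
  occur at most at \<open>x = Z\<close>.
\<close>

section \<open>Increasing affine maps\<close>

lemma T2_I: "a > 0 \<Longrightarrow> (\<lambda>y. a * y + c) \<in> T2"
  by (auto simp: T2_def)

lemma T2_E:
  assumes "t \<in> T2"
  obtains a c where "a > 0" "t = (\<lambda>y. a * y + c)"
  using assms by (auto simp: T2_def)

lemma T2_translation: "(\<lambda>y. y - c) \<in> T2"
  using T2_I[of 1 "- c"] by simp

lemma T2_comp:
  assumes "s \<in> T2" "t \<in> T2"
  shows "(\<lambda>y. s (t y)) \<in> T2"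
proof -
  obtain a c where s: "a > 0" "s = (\<lambda>y. a * y + c)" using assms(1) by (rule T2_E)
  obtain b d where t: "b > 0" "t = (\<lambda>y. b * y + d)" using assms(2) by (rule T2_E)
  have "(\<lambda>y. s (t y)) = (\<lambda>y. (a * b) * y + (a * d + c))"
    by (simp add: s t algebra_simps)
  then show ?thesis using T2_I[of "a * b"] s t by simp
qed

lemma T2_inverse:
  assumes "t \<in> T2"
  obtains t' where "t' \<in> T2" "\<And>y. t' (t y) = y" "\<And>y. t (t' y) = y"
proof -
  obtain a c where t: "a > 0" "t = (\<lambda>y. a * y + c)" using assms by (rule T2_E)
  let ?t' = "\<lambda>y. (1 / a) * y + (- c / a)"
  have "?t' \<in> T2" by (rule T2_I) (use t in simp)
  moreover have "?t' (t y) = y" for y using t by (simp add: field_simps)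
  moreover have "t (?t' y) = y" for y using t by (simp add: field_simps)
  ultimately show ?thesis by (rule that)
qed

lemma T2_less_iff: "t \<in> T2 \<Longrightarrow> t x < t y \<longleftrightarrow> x < y"
  by (auto simp: T2_def)

text \<open>By commutation \<open>s x\<close> is again fixed by \<open>t\<close>, and an affine map
  other than the identity has at most one fixed point.\<close>

lemma T2_commute_fixed_point:
  assumes "s \<in> T2" "t \<in> T2" "\<And>y. s (t y) = t (s y)" "t x = x" "t z \<noteq> z"
  shows "s x = x"
proof -
  obtain a c where t: "a > 0" "t = (\<lambda>y. a * y + c)" using assms(2) by (rule T2_E)
  have fix_s: "t (s x) = s x" using assms(3)[of x] assms(4) by simp
  have "(a - 1) * (s x - x) = 0"
    using fix_s assms(4) by (simp add: t algebra_simps)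
  moreover have "a \<noteq> 1" using assms(4,5) by (auto simp: t)
  ultimately show ?thesis by simp
qed

lemma T2_common_fixed_point_commute:
  assumes "s \<in> T2" "t \<in> T2" "s z = z" "t z = z"
  shows "s (t y) = t (s y)"
proof -
  obtain a c where s: "s = (\<lambda>y. a * y + c)" using assms(1) by (rule T2_E)
  obtain b d where t: "t = (\<lambda>y. b * y + d)" using assms(2) by (rule T2_E)
  have c: "c = z - a * z" and d: "d = z - b * z" using assms(3,4) by (simp_all add: s t)
  show ?thesis unfolding s t c d by (simp add: algebra_simps)
qed


section \<open>Symmetries of the past\<close>

definition sym_below :: "(real \<Rightarrow> 's) \<Rightarrow> real \<Rightarrow> (real \<Rightarrow> real) \<Rightarrow> bool" where
  "sym_below f x s \<longleftrightarrow> s \<in> T2 \<and> (\<forall>y<x. f (s y) = f y)"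

lemma sym_below_T2: "sym_below f x s \<Longrightarrow> s \<in> T2"
  by (simp add: sym_below_def)

lemma sym_below_eq: "sym_below f x s \<Longrightarrow> y < x \<Longrightarrow> f (s y) = f y"
  by (simp add: sym_below_def)

lemma sym_below_mono: "sym_below f y s \<Longrightarrow> x \<le> y \<Longrightarrow> sym_below f x s"
  by (auto simp: sym_below_def)

text \<open>The inverse is a symmetry on the image of the ray below \<open>x\<close>, so the bound
  moves to \<open>s x\<close>, which may lie on either side of \<open>x\<close>.\<close>

lemma sym_below_inverse:
  assumes "sym_below f x s"
  obtains s' where "sym_below f (s x) s'" "\<And>y. s' (s y) = y" "\<And>y. s (s' y) = y"
proof -
  obtain s' where s': "s' \<in> T2" "\<And>y. s' (s y) = y" "\<And>y. s (s' y) = y"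
    using T2_inverse[OF sym_below_T2[OF assms]] by blast
  have "f (s' y) = f y" if "y < s x" for y
  proof -
    have "s' y < x" using that T2_less_iff[OF s'(1), of y "s x"] s'(2) by simp
    then show ?thesis using sym_below_eq[OF assms, of "s' y"] s'(3) by simp
  qed
  then have "sym_below f (s x) s'" using s'(1) by (simp add: sym_below_def)
  then show ?thesis using s'(2,3) by (rule that)
qed

lemma sym_below_conjugate:
  assumes "sym_below (f \<circ> u) x s" "u \<in> T2" "u' \<in> T2" "\<And>y. u' (u y) = y" "\<And>y. u (u' y) = y"
  shows "sym_below f (u x) (\<lambda>y. u (s (u' y)))"
proof -
  have "f (u (s (u' y))) = f y" if "y < u x" for y
  proof -
    have "u' y < x" using that T2_less_iff[OF assms(3), of y "u x"] assms(4) by simp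
    then show ?thesis using sym_below_eq[OF assms(1), of "u' y"] assms(5) by simp
  qed
  moreover have "(\<lambda>y. u (s (u' y))) \<in> T2"
    using T2_comp[OF assms(2) T2_comp[OF sym_below_T2[OF assms(1)] assms(3)]] .
  ultimately show ?thesis by (simp add: sym_below_def)
qed

text \<open>A left-moving symmetry maps the past into the past, so whether it is one depends on the
  values below \<open>x\<close> alone. This is what makes guessing by symmetry legitimate for a
  predictor.\<close>

lemma sym_below_agree:
  assumes "\<forall>y<x. f y = g y" "sym_below f x s" "s x < x"
  shows "sym_below g x s"
proof -
  have "s y < x" if "y < x" for y
    using that T2_less_iff[OF sym_below_T2[OF assms(2)], of y x] assms(3) by simp
  then show ?thesis using assms by (auto simp: sym_below_def)
qed

section \<open>Correctness of guesses by commuting symmetries\<close>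

text \<open>Since \<open>r\<close> persists beyond \<open>x\<close>, it carries \<open>x\<close>
  into the past without changing the value of \<open>f\<close>; there \<open>s\<close> is known to
  preserve \<open>f\<close>, and commutation leads back to \<open>s x\<close>.\<close>

lemma commuting_sym_below_correct:
  assumes s: "sym_below f x s" "s x < x"
    and r: "sym_below f w r" "x < w" "r x < x"
    and comm: "s (r x) = r (s x)"
  shows "f (s x) = f x"
proof -
  have "f (s x) = f (r (s x))" using sym_below_eq[OF r(1), of "s x"] s(2) r(2) by simp
  also have "\<dots> = f (r x)" using sym_below_eq[OF s(1) r(3)] comm by simp
  also have "\<dots> = f x" using sym_below_eq[OF r(1,2)] .
  finally show ?thesis .
qed

lemma commuting_sym_below_correct':
  assumes s: "sym_below f x s" "s x < x"
    and t: "sym_below f w t" "x < w" "t w \<noteq> w"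
    and comm: "\<And>y. s (t y) = t (s y)"
  shows "f (s x) = f x"
proof -
  \<comment> \<open>If \<open>t\<close> fixed \<open>x\<close>, so would \<open>s\<close>, contrary
    to \<open>s x < x\<close>.\<close>
  have "t x \<noteq> x"
    using T2_commute_fixed_point[of s t x w] s t comm sym_below_T2 by fastforce
  then consider "t x < x" | "x < t x" by linarith
  then show ?thesis
  proof cases
    case 1
    then show ?thesis using commuting_sym_below_correct[OF s t(1,2)] comm by blast
  next
    case 2
    \<comment> \<open>If \<open>t\<close> moves \<open>x\<close> to the right, its inverse moves
      \<open>x\<close> to the left and still persists beyond \<open>x\<close>, because
      \<open>x < t x < t w\<close>.\<close>
    obtain r where r: "sym_below f (t w) r" "\<And>y. r (t y) = y" "\<And>y. t (r y) = y"
      using sym_below_inverse[OF t(1)] by blast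
    have "t x < t w" using T2_less_iff[OF sym_below_T2[OF t(1)]] t(2) by simp
    then have "x < t w" using 2 by simp
    moreover have "r x < x"
      using T2_less_iff[OF sym_below_T2[OF r(1)], of x "t x"] 2 r(2) by simp
    moreover have "s (r x) = r (s x)" using comm[of "r x"] r by metis
    ultimately show ?thesis using commuting_sym_below_correct[OF s r(1)] by blast
  qed
qed


section \<open>Periodic pasts\<close>

definition periodic_below :: "(real \<Rightarrow> 's) \<Rightarrow> real \<Rightarrow> real \<Rightarrow> bool" where
  "periodic_below f x c \<longleftrightarrow> c > 0 \<and> (\<forall>y<x. f (y - c) = f y)"

lemma periodic_below_iff: "periodic_below f x c \<longleftrightarrow> c > 0 \<and> sym_below f x (\<lambda>y. y - c)"
  by (simp add: periodic_below_def sym_below_def T2_translation)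

lemma periodic_below_mono: "periodic_below f y c \<Longrightarrow> x \<le> y \<Longrightarrow> periodic_below f x c"
  by (auto simp: periodic_below_def)

lemma periodic_below_multiple:
  assumes "periodic_below f x c" "y < x"
  shows "f (y - real n * c) = f y"
proof (induction n)
  case (Suc n)
  have "c > 0" using assms by (simp add: periodic_below_def)
  then have "real n * c \<ge> 0" by simp
  then have "y - real n * c < x" using assms(2) by linarith
  then have "f ((y - real n * c) - c) = f (y - real n * c)"
    using assms(1) by (simp add: periodic_below_def)
  then show ?case using Suc by (simp add: algebra_simps)
qed simp

text \<open>Steps of length \<open>c\<close> bring any point below \<open>w\<close> under
  \<open>z\<close>, where \<open>d\<close> is a period, without changing values. Hence all periodic
  rays of \<open>f\<close> share their periods.\<close>

lemma periodic_below_extend: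
  assumes d: "periodic_below f z d" and c: "periodic_below f w c"
  shows "periodic_below f w d"
proof -
  have pos: "c > 0" "d > 0" using c d by (auto simp: periodic_below_def)
  have "f (y - d) = f y" if y: "y < w" for y
  proof -
    obtain n where "y - z < real n * c" using reals_Archimedean3[OF pos(1)] by blast
    then have "f ((y - real n * c) - d) = f (y - real n * c)"
      using d by (simp add: periodic_below_def)
    moreover have "(y - real n * c) - d = (y - d) - real n * c" by simp
    moreover have "f ((y - d) - real n * c) = f (y - d)"
      by (rule periodic_below_multiple[OF c]) (use y pos in linarith)
    ultimately show ?thesis using periodic_below_multiple[OF c y, of n] by metis
  qed
  then show ?thesis using pos by (simp add: periodic_below_def)
qed

lemma periodic_below_pullback:
  assumes p: "periodic_below f z d" and s: "sym_below f x s" and w: "w \<le> x" "s w \<le> z"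
  obtains c where "periodic_below f w c"
proof -
  obtain a b where ab: "a > 0" "s = (\<lambda>y. a * y + b)" using sym_below_T2[OF s] by (rule T2_E)
  have d: "d > 0" using p by (simp add: periodic_below_def)
  \<comment> \<open>Conjugation by \<open>s\<close>, of slope \<open>a\<close>, turns the
    translation by \<open>d\<close> into one by \<open>d / a\<close>.\<close>
  have "f (y - d / a) = f y" if y: "y < w" for y
  proof -
    have "s y < z" using T2_less_iff[OF sym_below_T2[OF s], of y w] y w by simp
    then have "f (s y - d) = f (s y)" using p by (simp add: periodic_below_def)
    moreover have "s y - d = s (y - d / a)" using ab by (simp add: field_simps)
    moreover have "d / a > 0" using d ab by simp
    then have "f (s (y - d / a)) = f (y - d / a)"
      using sym_below_eq[OF s, of "y - d / a"] y w by simp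
    moreover have "f (s y) = f y" using sym_below_eq[OF s, of y] y w by simp
    ultimately show ?thesis by simp
  qed
  then have "periodic_below f w (d / a)" using d ab by (simp add: periodic_below_def)
  then show ?thesis by (rule that)
qed

section \<open>Non-commuting symmetries\<close>

lemma noncommuting_imp_periodic:
  assumes s: "sym_below f x s" and t: "sym_below f x t" and "s (t y0) \<noteq> t (s y0)"
  obtains w d where "periodic_below f w d"
proof -
  obtain a b where ab: "a > 0" "s = (\<lambda>y. a * y + b)" using sym_below_T2[OF s] by (rule T2_E)
  obtain c e where ce: "c > 0" "t = (\<lambda>y. c * y + e)" using sym_below_T2[OF t] by (rule T2_E)
  \<comment> \<open>The maps \<open>t\<close> after \<open>s\<close> and \<open>s\<close> after
    \<open>t\<close> have the same slope; \<open>k\<close> is the difference of their constant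
    terms.\<close>
  define k where "k = (c * b + e) - (a * e + b)"
  have k: "t (s y) = s (t y) + k" for y
    by (simp add: ab ce k_def algebra_simps)
  have "k \<noteq> 0" using assms(3) k by simp
  obtain s' where s': "s' \<in> T2" "\<And>y. s' (s y) = y" "\<And>y. s (s' y) = y"
    using T2_inverse[OF sym_below_T2[OF s]] by blast
  obtain t' where t': "t' \<in> T2" "\<And>y. t' (t y) = y" "\<And>y. t (t' y) = y"
    using T2_inverse[OF sym_below_T2[OF t]] by blast
  \<comment> \<open>For \<open>y < m\<close> the points \<open>y\<close>, \<open>s y\<close> and
    \<open>t y\<close> all lie below \<open>x\<close>, so both symmetries apply in either
    order.\<close>
  define m where "m = min x (min (s' x) (t' x))"
  have fk: "f (v + k) = f v" if v: "v < s (t m)" for v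
  proof -
    define y where "y = t' (s' v)"
    have v_eq: "v = s (t y)" by (simp add: y_def s' t')
    have "y < m"
      using v T2_less_iff[OF sym_below_T2[OF s]] T2_less_iff[OF sym_below_T2[OF t]]
      by (simp add: v_eq)
    then have y: "y < x" "y < s' x" "y < t' x" by (auto simp: m_def)
    have sy: "s y < x" using y(2) T2_less_iff[OF sym_below_T2[OF s], of y "s' x"] s' by simp
    have ty: "t y < x" using y(3) T2_less_iff[OF sym_below_T2[OF t], of y "t' x"] t' by simp
    have "f (v + k) = f (t (s y))" by (simp add: v_eq k)
    also have "\<dots> = f y" using sym_below_eq[OF t sy] sym_below_eq[OF s y(1)] by simp
    also have "\<dots> = f v" using sym_below_eq[OF s ty] sym_below_eq[OF t y(1)] by (simp add: v_eq)
    finally show ?thesis .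
  qed
  show ?thesis
  proof (cases "k > 0")
    case True
    have "f (v - k) = f v" if "v < s (t m)" for v
      using fk[of "v - k"] that True by simp
    then have "periodic_below f (s (t m)) k"
      using True by (simp add: periodic_below_def)
    then show ?thesis by (rule that)
  next
    case False
    have "periodic_below f (s (t m)) (- k)"
      unfolding periodic_below_def using False \<open>k \<noteq> 0\<close> fk by simp
    then show ?thesis by (rule that)
  qed
qed

text \<open>Otherwise the maximal periodic ray ends at some \<open>Z \<le> x\<close>. A symmetry
  below \<open>w\<close> must fix this end point, and affine maps with a common fixed point
  commute.\<close>

lemma noncommuting_imp_periodic_below:
  assumes s: "sym_below f w s" and t: "sym_below f w t" and nc: "s (t y0) \<noteq> t (s y0)"
    and x: "x < w"
  shows "\<exists>c. periodic_below f x c"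
proof (rule ccontr)
  assume np: "\<nexists>c. periodic_below f x c"
  obtain v d where vd: "periodic_below f v d" using noncommuting_imp_periodic[OF s t nc] .
  \<comment> \<open>One period \<open>d\<close> suffices to define \<open>Z\<close>: by
    \<open>periodic_below_extend\<close> every periodic ray has period \<open>d\<close>.\<close>
  define Z where "Z = Sup {z. periodic_below f z d}"
  have le_x: "z < x" if "periodic_below f z c" for z c
    using np periodic_below_mono[OF that, of x] by (meson not_le)
  have bdd: "bdd_above {z. periodic_below f z d}"
    using le_x by (intro bdd_aboveI[of _ x]) (auto intro: less_imp_le)
  have upper: "z \<le> Z" if "periodic_below f z c" for z c
    unfolding Z_def by (rule cSup_upper[OF _ bdd]) (use periodic_below_extend[OF vd that] in simp)
  have "Z \<le> x" unfolding Z_def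
    by (rule cSup_least) (use vd le_x in \<open>auto intro: less_imp_le\<close>)
  have pZ: "periodic_below f Z d"
  proof -
    have "f (y - d) = f y" if "y < Z" for y
      using that less_cSup_iff[OF _ bdd, of y] vd
      by (auto simp: Z_def periodic_below_def)
    then show ?thesis using vd by (simp add: periodic_below_def)
  qed
  \<comment> \<open>A symmetry taking \<open>Z\<close> to the left would pull the periodicity below
    \<open>Z\<close> back to a ray ending beyond \<open>Z\<close>. The bound \<open>u\<close> is
    arbitrary so that this also covers inverses.\<close>
  have not_left: "\<not> r Z < Z" if r: "sym_below f u r" "Z < u" for r u
  proof
    assume left: "r Z < Z"
    obtain r' where r': "r' \<in> T2" "\<And>y. r' (r y) = y" "\<And>y. r (r' y) = y"
      using T2_inverse[OF sym_below_T2[OF r(1)]] by blast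
    have "Z < r' Z" using left T2_less_iff[OF r'(1), of "r Z" Z] r' by simp
    \<comment> \<open>The pullback reaches \<open>r' Z\<close>, but only as far as \<open>r\<close>
      is a symmetry.\<close>
    define q where "q = min u (r' Z)"
    have "r q \<le> r (r' Z)"
      using T2_less_iff[OF sym_below_T2[OF r(1)], of "r' Z" q] by (auto simp: q_def not_less)
    then obtain c where "periodic_below f q c"
      using periodic_below_pullback[OF pZ r(1), of q] r' by (auto simp: q_def)
    then have "q \<le> Z" by (rule upper)
    then show False using r(2) \<open>Z < r' Z\<close> by (auto simp: q_def)
  qed
  have fixed: "r Z = Z" if r: "sym_below f w r" for r
  proof (rule ccontr)
    assume "r Z \<noteq> Z"
    moreover have "\<not> r Z < Z" using not_left[OF r] x \<open>Z \<le> x\<close> by simp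
    ultimately have "Z < r Z" by simp
    obtain r' where r': "sym_below f (r w) r'" "\<And>y. r' (r y) = y"
      using sym_below_inverse[OF r] by metis
    have "r Z < r w" using T2_less_iff[OF sym_below_T2[OF r]] x \<open>Z \<le> x\<close> by simp
    then have "\<not> r' Z < Z" using not_left[OF r'(1)] \<open>Z < r Z\<close> by simp
    moreover have "r' Z < Z"
      using T2_less_iff[OF sym_below_T2[OF r'(1)], of Z "r Z"] \<open>Z < r Z\<close> r'(2) by simp
    ultimately show False by simp
  qed
  show False
    using T2_common_fixed_point_commute[OF sym_below_T2[OF s] sym_below_T2[OF t] fixed[OF s] fixed[OF t]]
      nc by blast
qed


section \<open>Guesses\<close>

definition periodic_guesses :: "(real \<Rightarrow> 's) \<Rightarrow> real \<Rightarrow> 's set" where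
  "periodic_guesses f x = {f (x - c) | c. periodic_below f x c}"

definition symmetric_guesses :: "(real \<Rightarrow> 's) \<Rightarrow> real \<Rightarrow> 's set" where
  "symmetric_guesses f x = {f (s x) | s. sym_below f x s \<and> s x < x}"

definition matches :: "(real \<Rightarrow> 's) \<Rightarrow> real \<Rightarrow> (real \<Rightarrow> 's) set" where
  "matches f x = {g. \<exists>t\<in>T2. \<forall>y<x. g (t y) = f y}"

definition least_match :: "(real \<Rightarrow> 's) rel \<Rightarrow> (real \<Rightarrow> 's) \<Rightarrow> real \<Rightarrow> (real \<Rightarrow> 's)" where
  "least_match r f x = wo_rel.minim r (matches f x)"

definition match_guesses :: "(real \<Rightarrow> 's) rel \<Rightarrow> (real \<Rightarrow> 's) \<Rightarrow> real \<Rightarrow> 's set" where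
  "match_guesses r f x = {least_match r f x (t x) | t. t \<in> T2 \<and> (\<forall>y<x. least_match r f x (t y) = f y)}"

text \<open>Translations commute with each other, hence come first. Where no period exists,
  non-commuting symmetries can occur at one point at most.\<close>

definition guesses :: "(real \<Rightarrow> 's) rel \<Rightarrow> (real \<Rightarrow> 's) \<Rightarrow> real \<Rightarrow> 's set" where
  "guesses r f x =
    (if periodic_guesses f x \<noteq> {} then periodic_guesses f x
     else if symmetric_guesses f x \<noteq> {} then symmetric_guesses f x
     else match_guesses r f x)"

lemma guesses_agree:
  assumes "\<forall>y<x. f y = g y"
  shows "guesses r f x = guesses r g x"
proof -
  have per: "periodic_guesses f x \<subseteq> periodic_guesses g x" if "\<forall>y<x. f y = g y" for f g :: "real \<Rightarrow> 's"
    using that by (fastforce simp: periodic_guesses_def periodic_below_def)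
  have sym: "symmetric_guesses f x \<subseteq> symmetric_guesses g x" if "\<forall>y<x. f y = g y" for f g :: "real \<Rightarrow> 's"
    using that sym_below_agree[OF that] by (fastforce simp: symmetric_guesses_def)
  have "matches f x = matches g x" using assms by (simp add: matches_def)
  then have "match_guesses r f x = match_guesses r g x"
    using assms by (simp add: match_guesses_def least_match_def)
  moreover have "periodic_guesses f x = periodic_guesses g x"
    using per[of f g] per[of g f] assms by auto
  moreover have "symmetric_guesses f x = symmetric_guesses g x"
    using sym[of f g] sym[of g f] assms by auto
  ultimately show ?thesis by (simp add: guesses_def)
qed

section \<open>Equivariance of the guesses\<close>

text \<open>The reverse inclusion is the assumed one for the inverse of \<open>u\<close>.\<close>

lemma T2_equivariant_eqI:
  assumes sub: "\<And>(f :: real \<Rightarrow> 's) u x. u \<in> T2 \<Longrightarrow> G (f \<circ> u) x \<subseteq> G f (u x)" and "u \<in> T2"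
  shows "G (f \<circ> u) x = G f (u x)"
proof
  obtain u' where u': "u' \<in> T2" "\<And>y. u' (u y) = y" "\<And>y. u (u' y) = y"
    using T2_inverse[OF assms(2)] by blast
  have "(f \<circ> u) \<circ> u' = f" using u' by (simp add: fun_eq_iff)
  then show "G f (u x) \<subseteq> G (f \<circ> u) x" using sub[OF u'(1), of "f \<circ> u" "u x"] u'(2) by simp
qed (rule sub[OF assms(2)])

lemma periodic_guesses_comp:
  fixes f :: "real \<Rightarrow> 's"
  assumes "u \<in> T2"
  shows "periodic_guesses (f \<circ> u) x = periodic_guesses f (u x)"
proof (rule T2_equivariant_eqI[OF _ assms])
  fix f :: "real \<Rightarrow> 's" and u x assume u: "u \<in> T2"
  obtain a b where ab: "a > 0" "u = (\<lambda>y. a * y + b)" using u by (rule T2_E)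
  obtain u' where u': "u' \<in> T2" "\<And>y. u' (u y) = y" "\<And>y. u (u' y) = y"
    using T2_inverse[OF u] by blast
  have shift: "u (y - c) = u y - a * c" for y c by (simp add: ab algebra_simps)
  show "periodic_guesses (f \<circ> u) x \<subseteq> periodic_guesses f (u x)"
  proof
    fix v assume "v \<in> periodic_guesses (f \<circ> u) x"
    then obtain c where c: "periodic_below (f \<circ> u) x c" "v = f (u (x - c))"
      by (auto simp: periodic_guesses_def)
    have "sym_below f (u x) (\<lambda>y. y - a * c)"
      using sym_below_conjugate[of f u x "\<lambda>y. y - c" u'] c(1) u u'
      by (simp add: periodic_below_iff shift)
    then have "periodic_below f (u x) (a * c)"
      using c(1) ab by (simp add: periodic_below_iff)
    then show "v \<in> periodic_guesses f (u x)"
      using c(2) by (auto simp: periodic_guesses_def shift)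
  qed
qed

lemma symmetric_guesses_comp:
  fixes f :: "real \<Rightarrow> 's"
  assumes "u \<in> T2"
  shows "symmetric_guesses (f \<circ> u) x = symmetric_guesses f (u x)"
proof (rule T2_equivariant_eqI[OF _ assms])
  fix f :: "real \<Rightarrow> 's" and u x assume u: "u \<in> T2"
  obtain u' where u': "u' \<in> T2" "\<And>y. u' (u y) = y" "\<And>y. u (u' y) = y"
    using T2_inverse[OF u] by blast
  show "symmetric_guesses (f \<circ> u) x \<subseteq> symmetric_guesses f (u x)"
  proof
    fix v assume "v \<in> symmetric_guesses (f \<circ> u) x"
    then obtain s where s: "sym_below (f \<circ> u) x s" "s x < x" "v = f (u (s x))"
      by (auto simp: symmetric_guesses_def)
    have "sym_below f (u x) (\<lambda>y. u (s (u' y)))"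
      using sym_below_conjugate[OF s(1) u u'] .
    moreover have "u (s x) < u x" using T2_less_iff[OF u] s(2) by simp
    ultimately show "v \<in> symmetric_guesses f (u x)"
      unfolding symmetric_guesses_def using s(3) u'(2)
      by (intro CollectI exI[of _ "\<lambda>y. u (s (u' y))"]) simp
  qed
qed

lemma matching_comp:
  assumes "u \<in> T2" "u' \<in> T2" "\<And>y. u' (u y) = y" "\<And>y. u (u' y) = y"
    and "t \<in> T2" "\<forall>y<x. g (t y) = (f \<circ> u) y"
  shows "(\<lambda>y. t (u' y)) \<in> T2 \<and> (\<forall>y<u x. g (t (u' y)) = f y)"
proof (intro conjI allI impI)
  show "(\<lambda>y. t (u' y)) \<in> T2" using T2_comp[OF assms(5,2)] .
  fix y assume "y < u x"
  then have "u' y < x" using T2_less_iff[OF assms(2), of y "u x"] assms(3) by simp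
  then show "g (t (u' y)) = f y" using assms(4,6) by simp
qed

lemma matches_comp:
  fixes f :: "real \<Rightarrow> 's"
  assumes "u \<in> T2"
  shows "matches (f \<circ> u) x = matches f (u x)"
proof (rule T2_equivariant_eqI[OF _ assms])
  fix f :: "real \<Rightarrow> 's" and u x assume u: "u \<in> T2"
  obtain u' where u': "u' \<in> T2" "\<And>y. u' (u y) = y" "\<And>y. u (u' y) = y"
    using T2_inverse[OF u] by blast
  show "matches (f \<circ> u) x \<subseteq> matches f (u x)"
  proof
    fix g assume "g \<in> matches (f \<circ> u) x"
    then obtain t where "t \<in> T2" "\<forall>y<x. g (t y) = (f \<circ> u) y" unfolding matches_def by blast
    from matching_comp[OF u u' this] show "g \<in> matches f (u x)"
      unfolding matches_def by (intro CollectI bexI[of _ "\<lambda>y. t (u' y)"]) simp_all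
  qed
qed

lemma match_guesses_comp:
  fixes f :: "real \<Rightarrow> 's"
  assumes "u \<in> T2"
  shows "match_guesses r (f \<circ> u) x = match_guesses r f (u x)"
proof (rule T2_equivariant_eqI[OF _ assms])
  fix f :: "real \<Rightarrow> 's" and u x assume u: "u \<in> T2"
  obtain u' where u': "u' \<in> T2" "\<And>y. u' (u y) = y" "\<And>y. u (u' y) = y"
    using T2_inverse[OF u] by blast
  have eq: "least_match r (f \<circ> u) x = least_match r f (u x)"
    by (simp add: least_match_def matches_comp[OF u])
  show "match_guesses r (f \<circ> u) x \<subseteq> match_guesses r f (u x)"
  proof
    fix v assume "v \<in> match_guesses r (f \<circ> u) x"
    then obtain t where t: "t \<in> T2" "\<forall>y<x. least_match r f (u x) (t y) = (f \<circ> u) y"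
      and v: "v = least_match r f (u x) (t x)"
      by (auto simp: match_guesses_def eq)
    show "v \<in> match_guesses r f (u x)"
      unfolding match_guesses_def using matching_comp[OF u u' t] v u'(2)
      by (intro CollectI exI[of _ "\<lambda>y. t (u' y)"]) simp
  qed
qed

lemma guesses_comp:
  "u \<in> T2 \<Longrightarrow> guesses r (f \<circ> u) x = guesses r f (u x)"
  by (simp add: guesses_def periodic_guesses_comp symmetric_guesses_comp match_guesses_comp)


section \<open>Wrong guesses\<close>

lemma countable_at_most_one:
  fixes A :: "'a :: linorder set"
  assumes "\<And>x y. x \<in> A \<Longrightarrow> y \<in> A \<Longrightarrow> x < y \<Longrightarrow> False"
  shows "countable A"
proof (cases "A = {}")
  case False
  then obtain a where "a \<in> A" by blast
  then have "A \<subseteq> {a}" using assms by (metis insertI1 neqE subsetI)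
  then show ?thesis by (rule countable_subset) simp
qed simp

text \<open>A rational between each point and its successor in \<open>A\<close> gives an injection
  into the rationals; above a maximum any rational will do.\<close>

lemma countable_well_ordered_reals:
  fixes A :: "real set"
  assumes least: "\<And>B. B \<subseteq> A \<Longrightarrow> B \<noteq> {} \<Longrightarrow> \<exists>m\<in>B. \<forall>b\<in>B. m \<le> b"
  shows "countable A"
proof -
  have "\<exists>q\<in>\<rat>. x < q \<and> (\<forall>y\<in>A. x < y \<longrightarrow> q < y)" if "x \<in> A" for x
  proof (cases "{y \<in> A. x < y} = {}")
    case True
    obtain q where "q \<in> \<rat>" "x < q" using Rats_dense_in_real[of x "x + 1"] by auto
    then show ?thesis using True by blast
  next
    case False
    then obtain m where m: "m \<in> A" "x < m" "\<And>y. y \<in> A \<Longrightarrow> x < y \<Longrightarrow> m \<le> y"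
      using least[of "{y \<in> A. x < y}"] by auto
    obtain q where "q \<in> \<rat>" "x < q" "q < m" using Rats_dense_in_real[OF m(2)] by auto
    then show ?thesis using m(3) by force
  qed
  then obtain q where q: "\<And>x. x \<in> A \<Longrightarrow> q x \<in> \<rat>" "\<And>x. x \<in> A \<Longrightarrow> x < q x"
    "\<And>x y. x \<in> A \<Longrightarrow> y \<in> A \<Longrightarrow> x < y \<Longrightarrow> q x < y"
    by metis
  have "inj_on q A"
  proof (rule inj_onI, rule ccontr)
    fix x y assume "x \<in> A" "y \<in> A" "q x = q y" "x \<noteq> y"
    then show False using q(2)[of x] q(2)[of y] q(3)[of x y] q(3)[of y x] by linarith
  qed
  moreover have "countable (q ` A)"
    by (rule countable_subset[OF _ countable_rat]) (use q(1) in blast)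
  ultimately show ?thesis by (rule countable_image_inj_on[rotated])
qed

section \<open>Least matches\<close>

lemma self_match: "f \<in> matches f x"
  unfolding matches_def using T2_translation[of 0]
  by (intro CollectI bexI[of _ "\<lambda>y. y - 0"]) simp_all

lemma matches_antimono: "x \<le> y \<Longrightarrow> matches f y \<subseteq> matches f x"
  unfolding matches_def by (blast intro: less_le_trans)

lemma least_match_in:
  assumes "wo_rel r" "Field r = UNIV"
  shows "least_match r f x \<in> matches f x"
  unfolding least_match_def
  by (rule wo_rel.minim_in[OF assms(1)]) (use self_match in \<open>auto simp only: assms(2)\<close>)

lemma least_match_least:
  assumes "wo_rel r" "Field r = UNIV" "g \<in> matches f x"
  shows "(least_match r f x, g) \<in> r"
  unfolding least_match_def
  by (rule wo_rel.minim_least[OF assms(1) _ assms(3)]) (simp add: assms(2))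

text \<open>Matches are lost as \<open>x\<close> grows, so the least match moves up in
  \<open>r\<close>. Hence a point of \<open>B\<close> whose least match is \<open>r\<close>-minimal
  is the leftmost: one further left would have the same least match, though that match never
  recurs.\<close>

lemma countable_least_match_changes:
  assumes wo: "wo_rel r" "Field r = UNIV"
  shows "countable {x. \<forall>y>x. least_match r f y \<noteq> least_match r f x}"
proof (rule countable_well_ordered_reals)
  fix B assume B: "B \<subseteq> {x. \<forall>y>x. least_match r f y \<noteq> least_match r f x}" "B \<noteq> {}"
  let ?g = "least_match r f"
  let ?m = "wo_rel.minim r (?g ` B)"
  have "?m \<in> ?g ` B" by (rule wo_rel.minim_in[OF wo(1)]) (use wo B in auto)
  then obtain m where m: "m \<in> B" "?m = ?g m" by blast
  have "m \<le> b" if b: "b \<in> B" for b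
  proof (rule ccontr)
    assume "\<not> m \<le> b"
    then have "b < m" by simp
    then have "?g m \<in> matches f b"
      using least_match_in[OF wo, of f m] matches_antimono[of b m f] by auto
    then have "(?g b, ?g m) \<in> r" by (rule least_match_least[OF wo])
    moreover have "(?m, ?g b) \<in> r"
      by (rule wo_rel.minim_least[OF wo(1)]) (use wo b in auto)
    ultimately have "?g b = ?g m"
      using wo_rel.ANTISYM[OF wo(1)] m(2) by (auto dest: antisymD)
    then show False using B b \<open>b < m\<close> by fastforce
  qed
  then show "\<exists>m\<in>B. \<forall>b\<in>B. m \<le> b" using m(1) by blast
qed

text \<open>As the least match is unchanged at \<open>y\<close>, some reparametrisation
  \<open>t0\<close> of it agrees with \<open>f\<close> at \<open>x\<close> too. It remains to see
  that \<open>t\<close> and \<open>t0\<close> agree at \<open>x\<close>.\<close>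

lemma match_guesses_correct:
  assumes wo: "wo_rel r" "Field r = UNIV"
    and no_sym: "symmetric_guesses f x = {}"
    and y: "x < y" "least_match r f y = least_match r f x"
    and v: "v \<in> match_guesses r f x"
  shows "v = f x"
proof -
  let ?g = "least_match r f x"
  obtain t where t: "t \<in> T2" "\<And>z. z < x \<Longrightarrow> ?g (t z) = f z" "v = ?g (t x)"
    using v by (auto simp: match_guesses_def)
  obtain t0 where t0: "t0 \<in> T2" "\<And>z. z < y \<Longrightarrow> ?g (t0 z) = f z"
    using least_match_in[OF wo, of f y] y(2) by (auto simp: matches_def)
  \<comment> \<open>If \<open>p x < q x\<close>, the inverse of \<open>q\<close> after
    \<open>p\<close> is a symmetry of the past moving \<open>x\<close> to the left.\<close>
  have not_less: "\<not> p x < q x"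
    if p: "p \<in> T2" "\<And>z. z < x \<Longrightarrow> ?g (p z) = f z" and q: "q \<in> T2" "\<And>z. z < x \<Longrightarrow> ?g (q z) = f z"
    for p q
  proof
    assume less: "p x < q x"
    obtain q' where q': "q' \<in> T2" "\<And>y. q' (q y) = y" "\<And>y. q (q' y) = y"
      using T2_inverse[OF q(1)] by blast
    have left: "q' (p x) < x" using less T2_less_iff[OF q'(1), of "p x" "q x"] q' by simp
    have "f (q' (p z)) = f z" if z: "z < x" for z
    proof -
      have "q' (p z) < q' (p x)" using z T2_less_iff[OF p(1)] T2_less_iff[OF q'(1)] by simp
      then have "?g (q (q' (p z))) = f (q' (p z))" using q(2) left by simp
      then show ?thesis using q'(3) p(2)[OF z] by simp
    qed
    then have "sym_below f x (\<lambda>z. q' (p z))"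
      using T2_comp[OF q'(1) p(1)] by (simp add: sym_below_def)
    then have "f (q' (p x)) \<in> symmetric_guesses f x"
      using left by (auto simp: symmetric_guesses_def intro!: exI[of _ "\<lambda>z. q' (p z)"])
    then show False using no_sym by simp
  qed
  have t0x: "\<And>z. z < x \<Longrightarrow> ?g (t0 z) = f z" using t0(2) y(1) by simp
  have "t x = t0 x"
    using not_less[OF t(1,2) t0(1) t0x] not_less[OF t0(1) t0x t(1,2)] by linarith
  then show ?thesis using t(3) t0(2)[OF y(1)] by simp
qed

section \<open>Counting the errors\<close>

lemma countable_wrong_periodic_guesses: "countable {x. \<exists>v\<in>periodic_guesses f x. v \<noteq> f x}"
proof (rule countable_at_most_one, clarsimp simp: periodic_guesses_def)
  fix x y c d assume "x < y" and c: "periodic_below f x c" "f (x - c) \<noteq> f x" and d: "periodic_below f y d"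
  have "f (x - c) = f x"
    by (rule commuting_sym_below_correct[of f x "\<lambda>y. y - c" y "\<lambda>y. y - d"])
      (use c d \<open>x < y\<close> in \<open>auto simp: periodic_below_iff\<close>)
  then show False using c(2) by simp
qed

text \<open>There are at most two such points: one where symmetries fail to commute, and one where
  they all commute.\<close>

lemma countable_wrong_symmetric_guesses:
  "countable {x. periodic_guesses f x = {} \<and> (\<exists>v\<in>symmetric_guesses f x. v \<noteq> f x)}"
proof -
  define noncomm where "noncomm = {x. periodic_guesses f x = {} \<and>
    (\<exists>s t y. sym_below f x s \<and> sym_below f x t \<and> s (t y) \<noteq> t (s y))}"
  let ?W = "{x. periodic_guesses f x = {} \<and> (\<exists>v\<in>symmetric_guesses f x. v \<noteq> f x)}"
  have "countable noncomm"
  proof (rule countable_at_most_one)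
    fix x w assume "x \<in> noncomm" "w \<in> noncomm" "x < w"
    then have "\<exists>c. periodic_below f x c"
      using noncommuting_imp_periodic_below[of f w] by (auto simp: noncomm_def)
    then show False using \<open>x \<in> noncomm\<close> by (auto simp: noncomm_def periodic_guesses_def)
  qed
  moreover have "countable (?W - noncomm)"
  proof (rule countable_at_most_one)
    fix x w assume x: "x \<in> ?W - noncomm" and w: "w \<in> ?W - noncomm" and "x < w"
    obtain s where s: "sym_below f x s" "s x < x" "f (s x) \<noteq> f x"
      using x by (auto simp: symmetric_guesses_def)
    obtain t where t: "sym_below f w t" "t w < w"
      using w by (auto simp: symmetric_guesses_def)
    \<comment> \<open>The symmetry \<open>t\<close> found at the later point \<open>w\<close> is
      also one at \<open>x\<close>, so it commutes with \<open>s\<close> and vindicates the guess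
      there.\<close>
    have "sym_below f x t" using sym_below_mono[OF t(1)] \<open>x < w\<close> by simp
    then have "s (t y) = t (s y)" for y using x s(1) by (auto simp: noncomm_def)
    then have "f (s x) = f x"
      using commuting_sym_below_correct'[OF s(1,2) t(1) \<open>x < w\<close>] t(2) by simp
    then show False using s(3) by simp
  qed
  ultimately have "countable (noncomm \<union> (?W - noncomm))" by (rule countable_Un)
  then show ?thesis by (rule countable_subset[rotated]) blast
qed

lemma guesses_nonempty:
  assumes "wo_rel r" "Field r = UNIV"
  shows "guesses r f x \<noteq> {}"
proof -
  have "match_guesses r f x \<noteq> {}"
    using least_match_in[OF assms, of f x] by (auto simp: match_guesses_def matches_def)
  then show ?thesis by (simp add: guesses_def)
qed

lemma countable_wrong_guesses:
  assumes wo: "wo_rel r" "Field r = UNIV"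
  shows "countable {x. \<exists>v\<in>guesses r f x. v \<noteq> f x}"
proof (rule countable_subset)
  show "countable ({x. \<exists>v\<in>periodic_guesses f x. v \<noteq> f x}
    \<union> {x. periodic_guesses f x = {} \<and> (\<exists>v\<in>symmetric_guesses f x. v \<noteq> f x)}
    \<union> {x. \<forall>y>x. least_match r f y \<noteq> least_match r f x})" (is "countable ?R")
    using countable_wrong_periodic_guesses countable_wrong_symmetric_guesses
      countable_least_match_changes[OF wo] by (intro countable_Un)
  show "{x. \<exists>v\<in>guesses r f x. v \<noteq> f x} \<subseteq> ?R"
    using match_guesses_correct[OF wo] by (auto simp: guesses_def split: if_splits)
qed

theorem theorem2:
  "\<exists>P :: (real \<Rightarrow> 's) \<Rightarrow> (real \<Rightarrow> 's).
     predictor P \<and> anonymous T2 P \<and> (\<forall>f. countable {x. P f x \<noteq> f x})"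
proof -
  obtain r :: "(real \<Rightarrow> 's) rel" where r: "Well_order r" "Field r = UNIV"
    using well_ordering[where 'a = "real \<Rightarrow> 's"] by (elim exE conjE)
  have wo: "wo_rel r" unfolding wo_rel_def by (rule r(1))
  \<comment> \<open>The choice depends only on the set of guesses, so equality of these sets yields
    both the predictor property and anonymity.\<close>
  define P where "P f x = (SOME v. v \<in> guesses r f x)" for f x
  have "predictor P"
    unfolding predictor_def
  proof (intro allI impI)
    fix f g :: "real \<Rightarrow> 's" and x assume "\<forall>y<x. f y = g y"
    then show "P f x = P g x" using guesses_agree[of x f g r] by (simp add: P_def)
  qed
  moreover have "anonymous T2 P"
    unfolding anonymous_def
  proof (intro allI ballI ext)
    fix f :: "real \<Rightarrow> 's" and t x assume "t \<in> T2"
    then show "P (f \<circ> t) x = (P f \<circ> t) x" by (simp add: P_def guesses_comp)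
  qed
  moreover have "countable {x. P f x \<noteq> f x}" for f
  proof (rule countable_subset[OF _ countable_wrong_guesses[OF wo r(2), of f]])
    have "P f x \<in> guesses r f x" for x
      unfolding P_def some_in_eq by (rule guesses_nonempty[OF wo r(2)])
    then show "{x. P f x \<noteq> f x} \<subseteq> {x. \<exists>v\<in>guesses r f x. v \<noteq> f x}" by blast
  qed
  ultimately show ?thesis by blast
qed

end
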